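(* Let $n\ge 4$ be an even integer and let $q=2^n$. Then for every $a\in\mathbb{F}_{q^4}^*$ the polynomial $$f_4(x)=x^{2q^3+2q^2+2q+3}+ax$$ is not a permutation polynomial of $\mathbb{F}_{q^4}$.
   Context: $\mathbb{F}_Q$ denotes the finite field with $Q$ elements and $\mathbb{F}_Q^*$ its nonzero elements. A polynomial $f\in\mathbb{F}_Q[x]$ is a permutation polynomial of $\mathbb{F}_Q$ if the map $c\mapsto f(c)$ is a bijection of $\mathbb{F}_Q$. *)

theory Defs
  imports "HOL-Computational_Algebra.Polynomial"
begin

definition permutation_polynomial :: "'a::{field, finite} poly \<Rightarrow> bool" where
  "permutation_polynomial f \<longleftrightarrow> bij (poly f)"

definition f4 :: "nat \<Rightarrow> 'a::field \<Rightarrow> 'a poly" where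
  "f4 q a = monom 1 (2 * q ^ 3 + 2 * q ^ 2 + 2 * q + 3) + monom a 1"

end

theory Submission
  imports Defs
begin

text \<open>
Write \<open>N\<close> for the norm from the field with \<open>q^4\<close> elements to its subfield \<open>K\<close> with \<open>q\<close> elements. The
polynomial is \<open>x (N(x)^2 + a)\<close>, and taking norms gives \<open>N(f(x)) = G(N(x))\<close> with
\<open>G(y) = y N(y^2 + a)\<close> on \<open>K\<close>. As \<open>N\<close> is onto \<open>K\<close>, a permutation polynomial \<open>f\<close> would force \<open>G\<close> to
permute \<open>K\<close> (\<open>bij_reduced\<close>). If \<open>X^4 + \<alpha> X^3 + \<beta> X^2 + \<gamma> X + \<delta>\<close> is the characteristic polynomial
of \<open>a\<close> over \<open>K\<close>, then \<open>G = X^9 + \<alpha> X^7 + \<beta> X^5 + \<gamma> X^3 + \<delta> X\<close>.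

The criterion of Hermite refutes this: if \<open>G\<close> permutes \<open>K\<close> and \<open>0 < k < q - 1\<close>, then the coefficients
of \<open>G^k\<close> at the positive multiples of \<open>q - 1\<close> add up to 0. As \<open>n\<close> is even, \<open>q = 4^m\<close>, and the
coefficients can be computed digit by digit in base 4, because fourth powers are additive. The
exponent \<open>k = (q - 1) / 3\<close>, all of whose digits are 1, gives \<open>\<gamma>^k = 1\<close>, so \<open>\<gamma>\<close> is not 0
(\<open>nonic_hermite_third\<close>). If \<open>m \<ge> 3\<close>, the exponent \<open>k\<close> that ends in the digits 0, 1, 3 after
ones gives a power of \<open>\<gamma>\<close> that has to be 0, since \<open>G^7\<close> is monic of degree \<open>63 = 4^3 - 1\<close>
(\<open>not_bij_nonic_large\<close>).

For \<open>q = 16\<close> some polynomials \<open>G\<close> of this shape do permute \<open>K\<close>, and it matters that the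
quartic is the characteristic polynomial of an element (\<open>not_bij_16\<close>). The exponents 5 and 3 give \<open>\<gamma>^5 = 1\<close> and
\<open>\<gamma>^2 + \<beta>^3 + \<delta> \<alpha>^2 = 0\<close>. If \<open>\<alpha> = 0\<close>, the quartic has a root in \<open>K\<close>, which is a second zero of \<open>G\<close>.
Otherwise scaling makes \<open>\<alpha> = 1\<close>, and a search over the remaining \<open>\<beta>\<close> and \<open>\<gamma>\<close> finds only
permutations whose quartic is a product of two quadratics over \<open>K\<close>. Then \<open>a\<close> is fixed by the square
of the Frobenius map \<open>x \<mapsto> x^q\<close>, and its trace \<open>\<alpha>\<close> vanishes after all.
\<close>

section \<open>Power sums over the subfield with q elements\<close>

lemma power_card_field:
  fixes x :: "'a::{field, finite}"
  shows "x ^ card (UNIV :: 'a set) = x"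
proof (cases "x = 0")
  case False
  have "x ^ card (UNIV - {0 :: 'a}) * \<Prod>(UNIV - {0}) = (\<Prod>y\<in>UNIV - {0}. x * y)"
    by (simp add: prod.distrib)
  also have "\<dots> = \<Prod>(UNIV - {0})"
    by (rule prod.reindex_bij_witness[of _ "\<lambda>y. y / x" "\<lambda>y. x * y"]) (use False in auto)
  finally have "x ^ card (UNIV - {0 :: 'a}) = 1"
    by simp
  moreover have "card (UNIV :: 'a set) = Suc (card (UNIV - {0 :: 'a}))"
    by (rule card_Suc_Diff1 [symmetric]) simp_all
  ultimately show ?thesis
    by (simp only: power_Suc mult_1_right)
qed (simp add: card_gt_0_iff)

lemma card_le_card_image_times:
  assumes "finite A" and "\<And>y. y \<in> f ` A \<Longrightarrow> card {x \<in> A. f x = y} \<le> d"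
  shows "card A \<le> card (f ` A) * d"
proof -
  have "card A = (\<Sum>y\<in>f ` A. card {x \<in> A. f x = y})"
    using sum.image_gen[OF assms(1), of "\<lambda>_. 1 :: nat" f] by simp
  also have "\<dots> \<le> card (f ` A) * d"
    using sum_bounded_above[of "f ` A" "\<lambda>y. card {x \<in> A. f x = y}" d] assms(2) by simp
  finally show ?thesis .
qed

locale binary_quartic_extension =
  fixes q n :: nat and K :: "'a::{field, finite} set"
  assumes q_eq: "q = 2 ^ n" and n_pos: "n > 0"
    and card_UNIV_eq: "card (UNIV :: 'a set) = q ^ 4"
    and K_eq: "K = {x. x ^ q = x}"
begin

lemma q_ge_2: "q \<ge> 2"
  using n_pos by (cases n) (auto simp: q_eq)

lemma q_pos: "q > 0"
  using q_ge_2 by simp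

lemma even_q: "even q"
  using n_pos by (simp add: q_eq)

lemma two_eq_0: "(2 :: 'a) = 0"
proof -
  have "(- 1 :: 'a) = (- 1) ^ (q ^ 4)"
    using power_card_field[of "- 1 :: 'a"] by (simp add: card_UNIV_eq)
  also have "\<dots> = 1"
    using even_q by simp
  finally have "1 + (- 1 :: 'a) = 1 + 1"
    by simp
  then show ?thesis
    by simp
qed

lemma CHAR_eq_2: "CHAR('a) = 2"
proof (rule CHAR_eqI)
  fix m :: nat
  assume m: "of_nat m = (0 :: 'a)"
  show "2 dvd m"
  proof (rule ccontr)
    assume "odd m"
    then obtain k where "m = 2 * k + 1"
      by (elim oddE)
    then have "of_nat m = (2 :: 'a) * of_nat k + 1"
      by simp
    then show False
      using m two_eq_0 by simp
  qed
qed (use two_eq_0 in simp)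

lemma add_self [simp]: "x + x = (0 :: 'a)"
  using two_eq_0 by (metis mult_2 mult_zero_left)

lemma add_self_left [simp]: "x + (x + y) = (y :: 'a)"
  by (simp flip: add.assoc)

lemma uminus_eq [simp]: "- x = (x :: 'a)"
  by (rule minus_unique) simp

lemma minus_eq [simp]: "x - y = (x + y :: 'a)"
  by (metis diff_conv_add_uminus uminus_eq)

lemma add_eq_0_iff_eq: "x + y = 0 \<longleftrightarrow> x = (y :: 'a)"
  by (metis add_eq_0_iff uminus_eq)

lemma power_2_power_add: "(x + y) ^ (2 ^ k) = x ^ (2 ^ k) + (y :: 'a) ^ (2 ^ k)"
  by (rule freshmans_dream') (simp_all add: CHAR_eq_2)

lemma frobenius_add: "(x + y) ^ q = x ^ q + (y :: 'a) ^ q"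
  unfolding q_eq by (rule power_2_power_add)

lemma square_add: "(x + y)\<^sup>2 = x\<^sup>2 + (y :: 'a)\<^sup>2"
  by (simp add: power2_eq_square algebra_simps)

lemma frobenius_4: "(((x ^ q) ^ q) ^ q) ^ q = (x :: 'a)"
proof -
  have "(((x ^ q) ^ q) ^ q) ^ q = x ^ (q ^ 4)"
    by (simp add: power4_eq_xxxx flip: power_mult)
  then show ?thesis
    using power_card_field[of x] by (simp add: card_UNIV_eq)
qed

lemma K_iff: "x \<in> K \<longleftrightarrow> x ^ q = x"
  by (simp add: K_eq)

lemma K_0 [simp]: "0 \<in> K" and K_1 [simp]: "1 \<in> K"
  using q_pos by (simp_all add: K_iff)

lemma K_add [intro]: "x \<in> K \<Longrightarrow> y \<in> K \<Longrightarrow> x + y \<in> K"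
  by (simp add: K_iff frobenius_add)

lemma K_mult [intro]: "x \<in> K \<Longrightarrow> y \<in> K \<Longrightarrow> x * y \<in> K"
  by (simp add: K_iff power_mult_distrib)

lemma K_power [intro]: "x \<in> K \<Longrightarrow> x ^ k \<in> K"
  by (simp add: K_iff flip: power_mult) (metis mult.commute power_mult)

lemma K_divide [intro]: "x \<in> K \<Longrightarrow> y \<in> K \<Longrightarrow> x / y \<in> K"
  by (simp add: K_iff power_divide)

text \<open>
At most \<open>q\<close> elements are roots of \<open>X^q + X\<close>. Conversely, \<open>K\<close> is the kernel of the additive map
\<open>x \<mapsto> x^q + x\<close>, whose values have relative trace 0 and so are roots of a polynomial of
degree \<open>q^3\<close>; the \<open>q^4\<close> field elements can only fit if the kernel has \<open>q\<close> elements.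
\<close>
lemma card_K: "card K = q"
proof (rule antisym)
  define p :: "'a poly" where "p = monom 1 q + monom 1 1"
  have coeff_p: "coeff p q = 1"
    using q_ge_2 by (simp add: p_def)
  have "degree p \<le> q"
    unfolding p_def using q_pos by (intro degree_add_le) (simp_all add: degree_monom_eq)
  have "card {x. poly p x = 0} \<le> q"
    using card_poly_roots_bound[of p] coeff_p \<open>degree p \<le> q\<close> by (metis coeff_0 le_trans zero_neq_one)
  also have "{x. poly p x = 0} = K"
    by (auto simp: p_def poly_monom K_iff add_eq_0_iff_eq)
  finally show "card K \<le> q" .
next
  define t :: "'a \<Rightarrow> 'a" where "t x = x ^ q + x" for x
  define r :: "'a poly" where "r = monom 1 (q ^ 3) + (monom 1 (q ^ 2) + (monom 1 q + monom 1 1))"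
  have q3: "q < q ^ 3" "q ^ 2 < q ^ 3" "1 < q ^ 3"
    using q_ge_2 power_strict_increasing[of 1 3 q] power_strict_increasing[of 2 3 q]
    by auto
  have coeff_r: "coeff r (q ^ 3) = 1"
    using q3 by (simp add: r_def)
  have "degree r \<le> q ^ 3"
    unfolding r_def using q3
    by (intro degree_add_le) (simp_all add: degree_monom_eq)
  then have roots_r: "card {x. poly r x = 0} \<le> q ^ 3"
    using card_poly_roots_bound[of r] coeff_r by (metis coeff_0 le_trans zero_neq_one)
  have trace_t: "poly r (t x) = 0" for x
  proof -
    have p2: "y ^ q ^ 2 = (y ^ q) ^ q" and p3: "y ^ q ^ 3 = ((y ^ q) ^ q) ^ q" for y :: 'a
      by (simp_all add: power2_eq_square power3_eq_cube flip: power_mult)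
    show ?thesis
      by (simp add: r_def t_def poly_monom p2 p3 frobenius_add frobenius_4 ac_simps)
  qed
  have "q ^ 4 \<le> card (range t) * card K"
    unfolding card_UNIV_eq[symmetric]
  proof (rule card_le_card_image_times)
    fix y
    assume "y \<in> range t"
    then obtain x0 where x0: "y = t x0"
      by auto
    have "(\<lambda>x. x + x0) ` {x \<in> UNIV. t x = y} \<subseteq> K"
      by (auto simp: x0 t_def K_iff frobenius_add) (metis add.commute add.left_commute add_self_left)
    then have "card ((\<lambda>x. x + x0) ` {x \<in> UNIV. t x = y}) \<le> card K"
      by (intro card_mono) auto
    then show "card {x \<in> UNIV. t x = y} \<le> card K"
      by (subst (asm) card_image) (auto simp: inj_on_def)
  qed simp
  also have "\<dots> \<le> q ^ 3 * card K"
  proof (rule mult_right_mono)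
    have "range t \<subseteq> {x. poly r x = 0}"
      using trace_t by auto
    then show "card (range t) \<le> q ^ 3"
      using card_mono[of "{x. poly r x = 0}" "range t"] roots_r by simp
  qed simp
  finally have "q ^ 3 * q \<le> q ^ 3 * card K"
    by (simp add: power_Suc2[symmetric] flip: power_Suc2)
  then show "q \<le> card K"
    using q_pos by simp
qed

lemma K_power_q_minus_1:
  assumes "x \<in> K" "x \<noteq> 0"
  shows "x ^ (q - 1) = 1"
proof -
  have "x * x ^ (q - 1) = x * 1"
    using assms q_pos by (simp add: K_iff flip: power_Suc)
  then show ?thesis
    using assms(2) mult_left_cancel by blast
qed

lemma exists_power_neq_1:
  assumes i: "0 < i" "i < q - 1"
  obtains z where "z \<in> K" "z \<noteq> 0" "z ^ i \<noteq> 1"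
proof -
  define p :: "'a poly" where "p = monom 1 i + monom 1 0"
  have "degree p \<le> i"
    unfolding p_def by (intro degree_add_le) (simp_all add: degree_monom_eq)
  moreover have "coeff p i = 1"
    using i by (simp add: p_def)
  ultimately have "card {x. poly p x = 0} \<le> i"
    using card_poly_roots_bound[of p] by (metis coeff_0 le_trans zero_neq_one)
  moreover have "card (K - {0}) = q - 1"
    by (simp add: card_K)
  ultimately have "\<not> K - {0} \<subseteq> {x. poly p x = 0}"
    using i card_mono[of "{x. poly p x = 0}" "K - {0}"] by auto
  then show ?thesis
    using that by (auto simp: p_def poly_monom add_eq_0_iff_eq)
qed

text \<open>
Multiplying the summation variable by a unit \<open>z\<close> multiplies the sum by \<open>z^j\<close>, so that the sum
vanishes as soon as some \<open>z^j\<close> differs from 1. In characteristic 2 the values \<open>q\<close> and \<open>q - 1\<close>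
of the remaining sums are 0 and 1.
\<close>
lemma power_sum_K:
  "(\<Sum>x\<in>K. x ^ j) = (if j > 0 \<and> (q - 1) dvd j then 1 else 0 :: 'a)"
proof -
  consider "j = 0" | "j > 0" "(q - 1) dvd j" | "j > 0" "\<not> (q - 1) dvd j"
    by auto
  then show ?thesis
  proof cases
    case 1
    have "even (card K)"
      by (simp add: card_K even_q)
    then have "of_nat (card K) = (0 :: 'a)"
      by (auto elim!: evenE simp: two_eq_0)
    then show ?thesis
      using 1 by simp
  next
    case 2
    have "(\<Sum>x\<in>K. x ^ j) = (\<Sum>x\<in>K - {0}. x ^ j)"
      using 2 by (intro sum.mono_neutral_right) auto
    also have "\<dots> = (\<Sum>x\<in>K - {0}. 1)"
    proof (rule sum.cong)
      fix x
      assume "x \<in> K - {0}"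
      then show "x ^ j = 1"
        using 2 K_power_q_minus_1[of x] by (auto elim!: dvdE simp: power_mult)
    qed simp
    also have "\<dots> = of_nat (q - 1)"
      by (simp add: card_K)
    also have "\<dots> = (1 :: 'a)"
    proof -
      have "odd (q - 1)"
        using even_q q_pos by simp
      then show ?thesis
        by (auto elim!: oddE simp: two_eq_0)
    qed
    finally show ?thesis
      using 2 by simp
  next
    case 3
    define i where "i = j mod (q - 1)"
    have i: "0 < i" "i < q - 1"
      using 3 q_ge_2 by (auto simp: i_def mod_greater_zero_iff_not_dvd)
    have pow: "x ^ j = x ^ i" if "x \<in> K" "x \<noteq> 0" for x
    proof -
      have "x ^ j = (x ^ (q - 1)) ^ (j div (q - 1)) * x ^ i"
        by (simp add: i_def flip: power_mult power_add)
      then show ?thesis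
        using K_power_q_minus_1[OF that] by simp
    qed
    obtain z where z: "z \<in> K" "z \<noteq> 0" "z ^ i \<noteq> 1"
      using exists_power_neq_1[OF i] .
    have "(\<Sum>x\<in>K. x ^ j) = (\<Sum>x\<in>K. (z * x) ^ j)"
      by (rule sum.reindex_bij_witness[of _ "\<lambda>x. z * x" "\<lambda>x. x / z"]) (use z in auto)
    also have "\<dots> = z ^ i * (\<Sum>x\<in>K. x ^ j)"
      using pow[OF z(1,2)] by (simp add: power_mult_distrib sum_distrib_left)
    finally have "(\<Sum>x\<in>K. x ^ j) = z ^ i * (\<Sum>x\<in>K. x ^ j)" .
    then have "(\<Sum>x\<in>K. x ^ j) = 0"
      using z(3) by (simp only: mult_cancel_right1) blast
    then show ?thesis
      using 3 by simp
  qed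
qed

end

section \<open>Coefficients of powers of an odd polynomial of degree 9\<close>

lemma coeff_power_char_2:
  fixes F :: "'a::comm_ring_1 poly"
  assumes "CHAR('a) = 2"
  shows "coeff (F ^ (2 ^ s)) j = (if 2 ^ s dvd j then coeff F (j div 2 ^ s) ^ (2 ^ s) else 0)"
proof -
  have "F ^ (2 ^ s) = (\<Sum>i\<le>degree F. monom (coeff F i) i) ^ (2 ^ s)"
    by (simp add: poly_as_sum_of_monoms)
  also have "\<dots> = (\<Sum>i\<le>degree F. monom (coeff F i) i ^ (2 ^ s))"
    by (rule freshmans_dream_sum') (simp_all add: assms)
  also have "coeff \<dots> j = (\<Sum>i\<le>degree F. if i * 2 ^ s = j then coeff F i ^ (2 ^ s) else 0)"
    by (simp add: coeff_sum monom_power mult.commute if_distrib cong: if_cong)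
  also have "\<dots> = (if 2 ^ s dvd j then coeff F (j div 2 ^ s) ^ (2 ^ s) else 0)"
  proof (cases "2 ^ s dvd j")
    case True
    then obtain i where j: "j = i * 2 ^ s"
      by (auto elim: dvdE simp: mult.commute)
    have "(\<Sum>i'\<le>degree F. if i' * 2 ^ s = j then coeff F i' ^ (2 ^ s) else 0) =
        (\<Sum>i'\<le>degree F. if i' = i then coeff F i' ^ (2 ^ s) else 0)"
      by (simp add: j)
    also have "\<dots> = coeff F i ^ (2 ^ s)"
      by (simp add: coeff_eq_0 power_0_left)
    finally show ?thesis
      by (simp add: j)
  qed (auto intro!: sum.neutral)
  finally show ?thesis .
qed

text \<open>
In characteristic 2 the power \<open>F^(2^s)\<close> only has terms at multiples of \<open>2^s\<close>. Splitting an
exponent into its low binary digits and the rest thus reduces a coefficient of a high power to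
coefficients of much lower powers.
\<close>
lemma coeff_mult_power_char_2:
  fixes F H :: "'a::comm_ring_1 poly"
  assumes "CHAR('a) = 2"
  shows "coeff (H * F ^ (2 ^ s)) j =
    (\<Sum>t\<le>j div 2 ^ s. coeff H (j - 2 ^ s * t) * coeff F t ^ (2 ^ s))"
proof -
  have "coeff (H * F ^ (2 ^ s)) j = (\<Sum>i\<le>j. coeff H (j - i) * coeff (F ^ (2 ^ s)) i)"
    by (subst mult.commute, subst coeff_mult) (simp add: mult.commute)
  also have "\<dots> = (\<Sum>i\<in>(\<lambda>t. 2 ^ s * t) ` {..j div 2 ^ s}. coeff H (j - i) * coeff (F ^ (2 ^ s)) i)"
  proof (rule sum.mono_neutral_right)
    show "(\<lambda>t. 2 ^ s * t) ` {..j div 2 ^ s} \<subseteq> {..j}"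
      by (auto simp: less_eq_div_iff_mult_less_eq mult.commute)
    show "\<forall>i\<in>{..j} - (\<lambda>t. 2 ^ s * t) ` {..j div 2 ^ s}. coeff H (j - i) * coeff (F ^ (2 ^ s)) i = 0"
    proof
      fix i
      assume i: "i \<in> {..j} - (\<lambda>t. 2 ^ s * t) ` {..j div 2 ^ s}"
      have "\<not> 2 ^ s dvd i"
      proof
        assume "2 ^ s dvd i"
        then have "i = 2 ^ s * (i div 2 ^ s)" "i div 2 ^ s \<le> j div 2 ^ s"
          using i by (auto intro: div_le_mono)
        then show False
          using i by blast
      qed
      then show "coeff H (j - i) * coeff (F ^ (2 ^ s)) i = 0"
        by (simp add: coeff_power_char_2[OF assms])
    qed
  qed simp
  also have "\<dots> = (\<Sum>t\<le>j div 2 ^ s. coeff H (j - 2 ^ s * t) * coeff F t ^ (2 ^ s))"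
    by (subst sum.reindex) (auto simp: inj_on_def coeff_power_char_2[OF assms])
  finally show ?thesis .
qed

lemma coeff_power_odd_poly:
  fixes F :: "'a::comm_semiring_1 poly"
  assumes "\<And>i. even i \<Longrightarrow> coeff F i = 0" and "odd (k + j)"
  shows "coeff (F ^ k) j = 0"
  using assms(2)
proof (induction k arbitrary: j)
  case 0
  then show ?case
    by (cases j) auto
next
  case (Suc k)
  have "coeff F i * coeff (F ^ k) (j - i) = 0" if "i \<le> j" for i
    using assms(1)[of i] Suc.IH[of "j - i"] Suc.prems that by (cases "even i") auto
  then show ?case
    by (simp add: coeff_mult)
qed

text \<open>
The polynomial \<open>X (X^8 + \<alpha> X^6 + \<beta> X^4 + \<gamma> X^2 + \<delta>)\<close>, the shape that the map on the subfield
takes below.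
\<close>
definition nonic :: "'a::comm_semiring_1 \<Rightarrow> 'a \<Rightarrow> 'a \<Rightarrow> 'a \<Rightarrow> 'a poly" where
  "nonic \<alpha> \<beta> \<gamma> \<delta> = [:0, \<delta>, 0, \<gamma>, 0, \<beta>, 0, \<alpha>, 0, 1:]"

lemma degree_nonic [simp]: "degree (nonic \<alpha> \<beta> \<gamma> (\<delta> :: 'a::comm_semiring_1)) = 9"
  by (simp add: nonic_def)

lemma coeff_nonic_even: "even i \<Longrightarrow> coeff (nonic \<alpha> \<beta> \<gamma> (\<delta> :: 'a::comm_semiring_1)) i = 0"
  by (auto simp: nonic_def coeff_pCons split: nat.splits)

lemma degree_power_nonic [simp]: "degree (nonic \<alpha> \<beta> \<gamma> (\<delta> :: 'a::idom) ^ k) = 9 * k"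
  by (subst degree_power_eq) (auto simp: nonic_def)

lemma coeff_power_nonic_top [simp]: "coeff (nonic \<alpha> \<beta> \<gamma> (\<delta> :: 'a::idom) ^ k) (9 * k) = 1"
proof -
  have "coeff (nonic \<alpha> \<beta> \<gamma> \<delta>) 9 = 1"
    by (simp add: nonic_def eval_nat_numeral)
  then show ?thesis
    using lead_coeff_power[of "nonic \<alpha> \<beta> \<gamma> \<delta>" k] by simp
qed

text \<open>
The number with \<open>m\<close> digits 1 in base 4, which is \<open>(4^m - 1) / 3\<close>. The recursion peels off the
lowest digit.
\<close>
primrec repunit4 :: "nat \<Rightarrow> nat" where
  "repunit4 0 = 0"
| "repunit4 (Suc m) = 1 + 4 * repunit4 m"

lemma repunit4_eq: "3 * repunit4 m + 1 = 4 ^ m"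
  by (induction m) auto

text \<open>
With \<open>G\<close> the polynomial, \<open>G^(1 + 4k)\<close> is \<open>G\<close> times a fourth power. The exponent \<open>4^(m+1) - 1\<close> is
3 modulo 4, so \<open>G\<close> can only contribute its terms of exponents 3 and 7. Exponent 7 would leave an
even exponent for the power of the odd polynomial, so that in each digit only \<open>\<gamma> X^3\<close> survives.
\<close>
lemma coeff_power_repunit4:
  assumes char: "CHAR('a::idom) = 2"
  shows "coeff (nonic \<alpha> \<beta> \<gamma> (\<delta> :: 'a) ^ repunit4 m) (4 ^ m - 1) = \<gamma> ^ repunit4 m"
proof (induction m)
  case (Suc m)
  define G where "G = nonic \<alpha> \<beta> \<gamma> \<delta>"
  define c where "c t = coeff G (4 ^ Suc m - 1 - 4 * t) * coeff (G ^ repunit4 m) t ^ 4" for t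
  have "coeff (G ^ repunit4 (Suc m)) (4 ^ Suc m - 1) =
      coeff (G * (G ^ repunit4 m) ^ (2 ^ 2)) (4 ^ Suc m - 1)"
    by (simp add: mult.commute flip: power_mult)
  also have "\<dots> = (\<Sum>t\<le>(4 ^ Suc m - 1) div 4. c t)"
    by (subst coeff_mult_power_char_2[OF char]) (simp add: c_def)
  also have "(4 ^ Suc m - 1) div 4 = (4 ^ m - 1 :: nat)"
    by simp
  also have "(\<Sum>t\<le>4 ^ m - 1. c t) = c (4 ^ m - 1)"
  proof -
    have "c t = 0" if t: "t \<le> 4 ^ m - 1" "t \<noteq> 4 ^ m - 1" for t
    proof (cases "even t = even (4 ^ m - 1 :: nat)")
      case False
      moreover have "even (repunit4 m) = even (4 ^ m - 1 :: nat)"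
        using repunit4_eq[of m] by presburger
      ultimately have "odd (repunit4 m + t)"
        by simp
      then have "coeff (G ^ repunit4 m) t = 0"
        unfolding G_def by (intro coeff_power_odd_poly coeff_nonic_even)
      then show ?thesis
        by (simp add: c_def)
    next
      case True
      then have "t + 2 \<le> 4 ^ m - 1"
        using t by presburger
      then have "11 \<le> 4 ^ Suc m - 1 - 4 * t"
        by simp
      then show ?thesis
        by (simp add: c_def G_def coeff_eq_0)
    qed
    then have "(\<Sum>t\<le>4 ^ m - 1. c t) = (\<Sum>t\<in>{4 ^ m - 1}. c t)"
      by (intro sum.mono_neutral_right) auto
    then show ?thesis
      by simp
  qed
  also have "\<dots> = \<gamma> ^ repunit4 (Suc m)"
  proof -
    have "4 ^ Suc m - 1 - 4 * (4 ^ m - 1) = (3 :: nat)"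
      by (simp add: right_diff_distrib')
    moreover have "coeff G 3 = \<gamma>"
      by (simp add: G_def nonic_def eval_nat_numeral)
    ultimately show ?thesis
      using Suc.IH by (simp add: c_def G_def mult.commute flip: power_mult)
  qed
  finally show ?case
    by (simp add: G_def)
qed simp

text \<open>
The lowest three base 4 digits of the exponent form 7, and \<open>G^7\<close> has degree 63, which is
precisely the largest number with three digits. Only its leading term, which is 1, can contribute
to the exponent \<open>4^(m+3) - 1\<close>; the remaining digits are all 1.
\<close>
lemma coeff_power_7_plus_repunit4:
  assumes char: "CHAR('a::idom) = 2"
  shows "coeff (nonic \<alpha> \<beta> \<gamma> (\<delta> :: 'a) ^ (7 + 64 * repunit4 m)) (4 ^ (m + 3) - 1) = \<gamma> ^ (64 * repunit4 m)"
proof -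
  define G where "G = nonic \<alpha> \<beta> \<gamma> \<delta>"
  define c where "c t = coeff (G ^ 7) (4 ^ (m + 3) - 1 - 64 * t) * coeff (G ^ repunit4 m) t ^ 64" for t
  have "coeff (G ^ (7 + 64 * repunit4 m)) (4 ^ (m + 3) - 1) =
      coeff (G ^ 7 * (G ^ repunit4 m) ^ (2 ^ 6)) (4 ^ (m + 3) - 1)"
    by (simp add: mult.commute power_add flip: power_mult)
  also have "\<dots> = (\<Sum>t\<le>(4 ^ (m + 3) - 1) div 64. c t)"
    by (subst coeff_mult_power_char_2[OF char]) (simp add: c_def)
  also have "(4 ^ (m + 3) - 1) div 64 = (4 ^ m - 1 :: nat)"
    by (simp add: power_add)
  also have "(\<Sum>t\<le>4 ^ m - 1. c t) = (\<Sum>t\<in>{4 ^ m - 1}. c t)"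
  proof (rule sum.mono_neutral_right)
    show "\<forall>t\<in>{..4 ^ m - 1} - {4 ^ m - 1}. c t = 0"
    proof
      fix t :: nat
      assume "t \<in> {..4 ^ m - 1} - {4 ^ m - 1}"
      then have "t + 1 \<le> 4 ^ m - 1"
        by auto
      then have "63 < 4 ^ (m + 3) - 1 - 64 * t"
        by (simp add: power_add)
      then show "c t = 0"
        by (simp add: c_def G_def coeff_eq_0)
    qed
  qed auto
  also have "\<dots> = \<gamma> ^ (64 * repunit4 m)"
  proof -
    have "4 ^ (m + 3) - 1 - 64 * (4 ^ m - 1) = (9 * 7 :: nat)"
      by (simp add: power_add right_diff_distrib')
    moreover have "coeff (G ^ 7) (9 * 7) = 1"
      unfolding G_def by (rule coeff_power_nonic_top)
    ultimately show ?thesis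
      using coeff_power_repunit4[OF char, of \<alpha> \<beta> \<gamma> \<delta> m]
      by (simp add: c_def G_def mult.commute flip: power_mult)
  qed
  finally show ?thesis
    by (simp add: G_def)
qed

lemma coeff_nonic_cube:
  assumes char: "CHAR('a::idom) = 2"
  shows "coeff (nonic \<alpha> \<beta> \<gamma> (\<delta> :: 'a) ^ 3) 15 = \<gamma>\<^sup>2 + \<beta> ^ 3 + \<delta> * \<alpha>\<^sup>2"
proof -
  define G where "G = nonic \<alpha> \<beta> \<gamma> \<delta>"
  have "coeff (G ^ 3) 15 = coeff (G * G ^ (2 ^ 1)) 15"
    by (simp add: power3_eq_cube power2_eq_square mult.assoc)
  also have "\<dots> = (\<Sum>t\<le>7. coeff G (15 - 2 * t) * coeff G t ^ 2)"
    by (subst coeff_mult_power_char_2[OF char]) simp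
  also have "\<dots> = \<gamma>\<^sup>2 + \<beta> ^ 3 + \<delta> * \<alpha>\<^sup>2"
    by (simp add: G_def nonic_def coeff_pCons eval_nat_numeral)
  finally show ?thesis
    by (simp add: G_def)
qed

section \<open>The criterion of Hermite for degree 9\<close>

context binary_quartic_extension
begin

lemma sum_poly_K:
  fixes F :: "'a poly"
  assumes "\<And>j. j > 0 \<Longrightarrow> (q - 1) dvd j \<Longrightarrow> j \<notin> J \<Longrightarrow> coeff F j = 0"
    and "finite J" and "\<And>j. j \<in> J \<Longrightarrow> j > 0 \<and> (q - 1) dvd j"
  shows "(\<Sum>x\<in>K. poly F x) = (\<Sum>j\<in>J. coeff F j)"
proof -
  have "(\<Sum>x\<in>K. poly F x) = (\<Sum>j\<le>degree F. coeff F j * (\<Sum>x\<in>K. x ^ j))"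
    by (simp add: poly_altdef sum_distrib_left) (rule sum.swap)
  also have "\<dots> = (\<Sum>j\<le>degree F. if j > 0 \<and> (q - 1) dvd j then coeff F j else 0)"
    by (intro sum.cong refl) (auto simp: power_sum_K)
  also have "\<dots> = (\<Sum>j\<in>{j. j \<le> degree F \<and> j > 0 \<and> (q - 1) dvd j}. coeff F j)"
    by (intro sum.mono_neutral_cong_right) auto
  also have "\<dots> = (\<Sum>j\<in>J. coeff F j)"
    using assms by (intro sum.mono_neutral_cong) (auto simp: coeff_eq_0 not_le)
  finally show ?thesis .
qed

lemma bij_power_sum_0:
  assumes bij: "bij_betw (poly F) K K" and k: "\<not> (q - 1) dvd k"
  shows "(\<Sum>x\<in>K. poly (F ^ k) x) = 0"
proof -
  have "(\<Sum>x\<in>K. poly (F ^ k) x) = (\<Sum>x\<in>K. x ^ k)"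
    using sum.reindex_bij_betw[OF bij, of "\<lambda>x. x ^ k"] by simp
  then show ?thesis
    using k by (simp add: power_sum_K)
qed

text \<open>
The sum of \<open>x^k\<close> over \<open>K\<close> is 0, and if \<open>G\<close> permutes \<open>K\<close> so is the sum of \<open>G(x)^k\<close>, which is the
sum of the coefficients of \<open>G^k\<close> at the positive multiples of \<open>q - 1\<close>. Here the degree \<open>9k\<close> leaves
only \<open>q - 1\<close> and \<open>2(q - 1)\<close>, and the latter has the wrong parity.
\<close>
lemma nonic_hermite:
  assumes bij: "bij_betw (poly (nonic \<alpha> \<beta> \<gamma> \<delta>)) K K"
    and q: "q > 2" and "odd k" and k: "3 * k < q - 1"
  shows "coeff (nonic \<alpha> \<beta> \<gamma> \<delta> ^ k) (q - 1) = 0"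
proof -
  define F where "F = nonic \<alpha> \<beta> \<gamma> \<delta> ^ k"
  have "(\<Sum>x\<in>K. poly F x) = (\<Sum>j\<in>{q - 1}. coeff F j)"
  proof (rule sum_poly_K)
    fix j
    assume j: "j > 0" "(q - 1) dvd j" "j \<notin> {q - 1}"
    then obtain i where i: "j = (q - 1) * i"
      by (elim dvdE)
    with j have "i \<noteq> 0" "i \<noteq> 1"
      by auto
    then consider "i = 2" | "i \<ge> 3"
      by linarith
    then show "coeff F j = 0"
    proof cases
      case 1
      then show ?thesis
        unfolding F_def using \<open>odd k\<close> by (intro coeff_power_odd_poly coeff_nonic_even) (simp_all add: i)
    next
      case 2
      have "9 * k < (q - 1) * 3"
        using k by simp
      also have "\<dots> \<le> j"
        unfolding i using 2 by (intro mult_left_mono) auto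
      finally show ?thesis
        by (simp add: F_def coeff_eq_0)
    qed
  qed (use q in auto)
  moreover have "(\<Sum>x\<in>K. poly F x) = 0"
    unfolding F_def
  proof (rule bij_power_sum_0[OF bij])
    have "0 < k" "k < q - 1"
      using \<open>odd k\<close> k by (auto intro: odd_pos)
    then show "\<not> (q - 1) dvd k"
      by (auto dest: dvd_imp_le)
  qed
  ultimately show ?thesis
    by (simp add: F_def)
qed

text \<open>
For \<open>k = (q - 1) / 3\<close> the degree \<open>9k\<close> equals \<open>3(q - 1)\<close>, and so the leading coefficient 1 joins
the coefficient at \<open>q - 1\<close>. It is here that 3 divides \<open>q - 1\<close>.
\<close>
lemma nonic_hermite_third:
  assumes bij: "bij_betw (poly (nonic \<alpha> \<beta> \<gamma> \<delta>)) K K"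
    and q: "q = 4 ^ m" and m: "m > 0"
  shows "\<gamma> ^ repunit4 m = 1"
proof -
  define k where "k = repunit4 m"
  define F where "F = nonic \<alpha> \<beta> \<gamma> \<delta> ^ k"
  have k: "q - 1 = 3 * k"
    using repunit4_eq[of m] by (simp add: k_def q)
  have "odd k"
    using m by (cases m) (simp_all add: k_def)
  then have "k > 0"
    by (rule odd_pos)
  have "(\<Sum>x\<in>K. poly F x) = (\<Sum>j\<in>{q - 1, 9 * k}. coeff F j)"
  proof (rule sum_poly_K)
    fix j
    assume j: "j > 0" "(q - 1) dvd j" "j \<notin> {q - 1, 9 * k}"
    then obtain i where i: "j = 3 * k * i"
      using that unfolding k by (elim dvdE)
    with j have "i \<noteq> 0" "i \<noteq> 1" "i \<noteq> 3"
      unfolding k by auto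
    then consider "i = 2" | "i \<ge> 4"
      by linarith
    then show "coeff F j = 0"
    proof cases
      case 1
      then show ?thesis
        unfolding F_def using \<open>odd k\<close> by (intro coeff_power_odd_poly coeff_nonic_even) (simp_all add: i)
    next
      case 2
      have "9 * k < 3 * k * 4"
        using \<open>k > 0\<close> by simp
      also have "\<dots> \<le> j"
        unfolding i using 2 by (intro mult_left_mono) auto
      finally show ?thesis
        by (simp add: F_def coeff_eq_0)
    qed
  qed (use \<open>k > 0\<close> in \<open>auto simp: k[unfolded One_nat_def]\<close>)
  also have "\<dots> = coeff F (q - 1) + coeff F (9 * k)"
    using \<open>k > 0\<close> by (simp only: k) simp
  also have "\<dots> = \<gamma> ^ k + 1"
    using coeff_power_repunit4[OF CHAR_eq_2, of \<alpha> \<beta> \<gamma> \<delta> m] by (simp add: F_def q k_def)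
  finally have "(\<Sum>x\<in>K. poly F x) = \<gamma> ^ k + 1" .
  moreover have "(\<Sum>x\<in>K. poly F x) = 0"
    unfolding F_def
    by (rule bij_power_sum_0[OF bij]) (use \<open>k > 0\<close> in \<open>auto dest: dvd_imp_le simp only: k\<close>)
  ultimately show ?thesis
    by (simp add: add_eq_0_iff_eq k_def)
qed

text \<open>
Since a power of \<open>\<gamma>\<close> is 1, it is not 0; but for \<open>k = 7 + 64 (1 + 4 + \<dots> + 4^(m-1))\<close> the
coefficient that has to vanish is a power of \<open>\<gamma>\<close>. This \<open>k\<close> needs three base 4 digits of \<open>q\<close>, which
is why \<open>q = 16\<close> is left over.
\<close>
lemma not_bij_nonic_large:
  assumes q: "q = 4 ^ (m + 3)"
  shows "\<not> bij_betw (poly (nonic \<alpha> \<beta> \<gamma> \<delta>)) K K"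
proof
  assume bij: "bij_betw (poly (nonic \<alpha> \<beta> \<gamma> \<delta>)) K K"
  have "\<gamma> ^ repunit4 (m + 3) = 1"
    using nonic_hermite_third[OF bij q] by simp
  then have "\<gamma> \<noteq> 0"
    by (auto simp: power_0_left split: if_splits) (simp add: eval_nat_numeral)
  have "coeff (nonic \<alpha> \<beta> \<gamma> \<delta> ^ (7 + 64 * repunit4 m)) (q - 1) = 0"
  proof (rule nonic_hermite[OF bij])
    show "3 * (7 + 64 * repunit4 m) < q - 1"
      using repunit4_eq[of m] by (simp add: q power_add)
    show "q > 2"
    proof -
      have "(4 :: nat) ^ m > 0"
        by simp
      then have "2 < 4 ^ m * (64 :: nat)"
        by linarith
      then show ?thesis
        by (simp add: q power_add)
    qed
  qed simp
  then show False
    using coeff_power_7_plus_repunit4[OF CHAR_eq_2, of \<alpha> \<beta> \<gamma> \<delta> m] \<open>\<gamma> \<noteq> 0\<close> by (simp add: q)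
qed

end

section \<open>From the field with q^4 elements down to its subfield\<close>

context binary_quartic_extension
begin

definition rel_norm :: "'a \<Rightarrow> 'a" where
  "rel_norm x = x * x ^ q * (x ^ q) ^ q * ((x ^ q) ^ q) ^ q"

lemma rel_norm_mult: "rel_norm (x * y) = rel_norm x * rel_norm y"
  by (simp add: rel_norm_def power_mult_distrib mult_ac)

lemma rel_norm_in_K: "rel_norm x \<in> K"
  by (simp add: K_iff rel_norm_def power_mult_distrib frobenius_4 mult_ac)

lemma rel_norm_K:
  assumes "y \<in> K"
  shows "rel_norm y = y ^ 4"
  using assms by (simp add: K_iff rel_norm_def power4_eq_xxxx)

lemma rel_norm_eq_0_iff [simp]: "rel_norm x = 0 \<longleftrightarrow> x = 0"
  using q_pos by (simp add: rel_norm_def)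

lemma rel_norm_eq_power: "rel_norm x = x ^ (q ^ 3 + q\<^sup>2 + q + 1)"
  by (simp add: rel_norm_def power_add mult_ac power2_eq_square power3_eq_cube flip: power_mult)

text \<open>
A fibre of the norm over a nonzero element has at most \<open>(q^4 - 1) / (q - 1)\<close> elements, so the
\<open>q^4 - 1\<close> units have at least \<open>q - 1\<close> values.
\<close>
lemma rel_norm_image: "range rel_norm = K"
proof
  show "range rel_norm \<subseteq> K"
    using rel_norm_in_K by auto
  define s where "s = q ^ 3 + q\<^sup>2 + q + 1"
  define A where "A = UNIV - {0 :: 'a}"
  have "card A \<le> card (rel_norm ` A) * s"
  proof (rule card_le_card_image_times)
    fix y :: 'a
    define p where "p = monom 1 s + [:y:]"
    have "s > 0"
      by (simp add: s_def)
    then have "degree p \<le> s" "coeff p s = 1"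
      unfolding p_def by (auto intro!: degree_add_le simp: degree_monom_le coeff_pCons split: nat.splits)
    then have "card {x. poly p x = 0} \<le> s"
      using card_poly_roots_bound[of p] by (metis coeff_0 le_trans zero_neq_one)
    moreover have "{x \<in> A. rel_norm x = y} \<subseteq> {x. poly p x = 0}"
      by (auto simp: p_def poly_monom rel_norm_eq_power s_def)
    ultimately show "card {x \<in> A. rel_norm x = y} \<le> s"
      using card_mono[of "{x. poly p x = 0}" "{x \<in> A. rel_norm x = y}"] by simp
  qed simp
  moreover have "card A = (q - 1) * s"
  proof -
    have "q ^ 4 = (q - 1) * s + 1"
      using q_pos by (cases q) (simp_all add: s_def algebra_simps eval_nat_numeral)
    then show ?thesis
      by (simp add: A_def card_UNIV_eq)
  qed
  ultimately have "(q - 1) * s \<le> card (rel_norm ` A) * s"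
    by simp
  moreover have "s > 0"
    by (simp add: s_def)
  ultimately have "card (K - {0}) \<le> card (rel_norm ` A)"
    by (simp add: card_K)
  moreover have "rel_norm ` A \<subseteq> K - {0}"
    using rel_norm_in_K by (auto simp: A_def)
  ultimately have "rel_norm ` A = K - {0}"
    by (intro card_seteq) auto
  then have "K \<subseteq> insert (rel_norm 0) (rel_norm ` A)"
    by auto
  then show "K \<subseteq> range rel_norm"
    by blast
qed

text \<open>
The map that \<open>f4 q a\<close> induces on the subfield: the norm intertwines the two.
\<close>
definition reduced :: "'a \<Rightarrow> 'a \<Rightarrow> 'a" where
  "reduced a y = y * rel_norm (y\<^sup>2 + a)"

lemma rel_norm_f4: "rel_norm (poly (f4 q a) x) = reduced a (rel_norm x)"
proof -
  have "poly (f4 q a) x = x * ((rel_norm x)\<^sup>2 + a)"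
    by (simp add: f4_def poly_monom rel_norm_eq_power power_add power_mult power3_eq_cube
        power2_eq_square algebra_simps)
  then have "rel_norm (poly (f4 q a) x) = rel_norm x * rel_norm ((rel_norm x)\<^sup>2 + a)"
    by (simp only: rel_norm_mult)
  then show ?thesis
    by (simp add: reduced_def)
qed

text \<open>
A surjective \<open>f4 q a\<close> makes the induced map surjective because the norm is onto \<open>K\<close>.
\<close>
lemma bij_reduced:
  assumes "permutation_polynomial (f4 q a)"
  shows "bij_betw (reduced a) K K"
proof -
  have "surj (poly (f4 q a))"
    using assms by (simp add: permutation_polynomial_def bij_is_surj)
  then have "K = rel_norm ` range (poly (f4 q a))"
    using rel_norm_image by simp
  also have "\<dots> = reduced a ` range rel_norm"
    by (auto simp: rel_norm_f4 image_image)
  finally have "reduced a ` K = K"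
    by (simp add: rel_norm_image)
  then show ?thesis
    by (simp add: bij_betw_def finite_surj_inj)
qed

text \<open>
The elementary symmetric functions of the four conjugates of \<open>a\<close>, the fourth one being the
relative norm; they are the coefficients of the characteristic polynomial of \<open>a\<close> over \<open>K\<close>.
\<close>
definition conj_e1 :: "'a \<Rightarrow> 'a" where
  "conj_e1 a = a + a ^ q + (a ^ q) ^ q + ((a ^ q) ^ q) ^ q"

definition conj_e2 :: "'a \<Rightarrow> 'a" where
  "conj_e2 a = (a + (a ^ q) ^ q) * (a ^ q + ((a ^ q) ^ q) ^ q) + a * (a ^ q) ^ q + a ^ q * ((a ^ q) ^ q) ^ q"

definition conj_e3 :: "'a \<Rightarrow> 'a" where
  "conj_e3 a = a * (a ^ q) ^ q * (a ^ q + ((a ^ q) ^ q) ^ q) + a ^ q * ((a ^ q) ^ q) ^ q * (a + (a ^ q) ^ q)"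

lemma conj_e_in_K: "conj_e1 a \<in> K" "conj_e2 a \<in> K" "conj_e3 a \<in> K"
  by (simp_all add: K_iff conj_e1_def conj_e2_def conj_e3_def frobenius_add power_mult_distrib frobenius_4 ac_simps)

lemma rel_norm_add:
  assumes "z \<in> K"
  shows "rel_norm (z + a) = z ^ 4 + conj_e1 a * z ^ 3 + conj_e2 a * z\<^sup>2 + conj_e3 a * z + rel_norm a"
  using assms
  by (simp add: K_iff rel_norm_def conj_e1_def conj_e2_def conj_e3_def frobenius_add
     power2_eq_square power3_eq_cube power4_eq_xxxx) (simp add: algebra_simps)

lemma conj_quartic_root:
  "a ^ 4 + conj_e1 a * a ^ 3 + conj_e2 a * a\<^sup>2 + conj_e3 a * a + rel_norm a = 0"
  by (simp add: K_iff rel_norm_def conj_e1_def conj_e2_def conj_e3_def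
     power2_eq_square power3_eq_cube power4_eq_xxxx) (simp add: algebra_simps)

lemma reduced_eq_nonic:
  assumes "y \<in> K"
  shows "reduced a y = poly (nonic (conj_e1 a) (conj_e2 a) (conj_e3 a) (rel_norm a)) y"
  using rel_norm_add[OF K_power[OF assms, of 2], of a]
  by (simp add: reduced_def nonic_def algebra_simps eval_nat_numeral)

lemma bij_reduced_iff_nonic:
  "bij_betw (reduced a) K K \<longleftrightarrow> bij_betw (poly (nonic (conj_e1 a) (conj_e2 a) (conj_e3 a) (rel_norm a))) K K"
  by (rule bij_betw_cong) (rule reduced_eq_nonic)

text \<open>
Replacing \<open>y\<close> by \<open>c y\<close> in the induced map amounts to dividing \<open>a\<close> by \<open>c^2\<close>. This allows the
relative trace of \<open>a\<close> to be normalized to 1 when it is not 0.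
\<close>
lemma bij_reduced_scale:
  assumes bij: "bij_betw (reduced a) K K" and c: "c \<in> K" "c \<noteq> 0"
  shows "bij_betw (reduced (a / c\<^sup>2)) K K"
proof -
  have eq: "reduced (a / c\<^sup>2) y = reduced a (c * y) / c ^ 9" if "y \<in> K" for y
  proof -
    have "(c * y)\<^sup>2 + a = c\<^sup>2 * (y\<^sup>2 + a / c\<^sup>2)"
      using c by (simp add: field_simps)
    then have "reduced a (c * y) = c * y * ((c\<^sup>2) ^ 4 * rel_norm (y\<^sup>2 + a / c\<^sup>2))"
      using c by (simp add: reduced_def rel_norm_mult rel_norm_K K_power)
    then have "reduced a (c * y) = c ^ 9 * reduced (a / c\<^sup>2) y"
      by (simp add: reduced_def algebra_simps eval_nat_numeral)
    then show ?thesis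
      using c by simp
  qed
  have "bij_betw ((*) c) K K"
    by (rule bij_betw_byWitness[where f' = "\<lambda>y. y / c"]) (use c in auto)
  moreover have "bij_betw (\<lambda>z. z / c ^ 9) K K"
    by (rule bij_betw_byWitness[where f' = "\<lambda>y. y * c ^ 9"]) (use c in auto)
  ultimately have "bij_betw ((\<lambda>z. z / c ^ 9) \<circ> (reduced a \<circ> (*) c)) K K"
    using bij by (blast intro: bij_betw_trans)
  then show ?thesis
    by (rule bij_betw_cong[THEN iffD1, rotated]) (simp add: eq)
qed

lemma conj_e1_scale:
  assumes "c \<in> K"
  shows "conj_e1 (a / c) = conj_e1 a / c"
  using assms by (simp add: conj_e1_def K_iff power_divide add_divide_distrib)

text \<open>
The other root of the quadratic is \<open>a + s\<close>, so \<open>a^q\<close> is \<open>a\<close> or \<open>a + s\<close>. Either way \<open>a^(q^2) = a\<close>,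
and in characteristic 2 the four conjugates cancel in pairs.
\<close>
lemma conj_e1_eq_0:
  assumes "a\<^sup>2 + s * a + t = 0" "s \<in> K" "t \<in> K"
  shows "conj_e1 a = 0"
proof -
  define b where "b = a ^ q"
  have "b\<^sup>2 + s * b + t = (a\<^sup>2 + s * a + t) ^ q"
    using assms(2,3) by (simp add: b_def frobenius_add power_mult_distrib K_iff flip: power_mult)
      (simp add: mult.commute)
  then have "b\<^sup>2 + s * b + t = 0"
    using assms(1) q_pos by simp
  then have "(a\<^sup>2 + s * a + t) + (b\<^sup>2 + s * b + t) = 0"
    using assms(1) by simp
  also have "(a\<^sup>2 + s * a + t) + (b\<^sup>2 + s * b + t) = (a + b) * (a + b + s)"
    by (simp add: algebra_simps power2_eq_square)
  finally consider "a + b = 0" | "a + b = s"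
    by (auto simp: add_eq_0_iff_eq)
  then have "(a + b) ^ q = a + b"
    using assms(2) q_pos by cases (auto simp: K_iff)
  then have "a ^ q + b ^ q = a + a ^ q"
    by (simp add: frobenius_add b_def)
  then have "(a ^ q) ^ q = a"
    by (simp add: b_def)
  then show ?thesis
    by (simp add: conj_e1_def ac_simps)
qed

end

section \<open>A search in the field with 16 elements\<close>

text \<open>
\<open>GF x0 x1 x2 x3\<close> stands for \<open>x0 + x1 z + x2 z^2 + x3 z^3\<close>, where \<open>z\<close> is a primitive fifth root of
unity over the field with two elements. The arithmetic on these codes is decided by rewriting,
and \<open>gf16_eval\<close> below transports the results to the subfield. Of the products in
\<open>gf16_mult\<close>, \<open>c4\<close> is the coefficient of \<open>z^4 = 1 + z + z^2 + z^3\<close>, while \<open>z^5 = 1\<close> and \<open>z^6 = z\<close>.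
\<close>
datatype gf16 = GF bool bool bool bool

fun gf16_add :: "gf16 \<Rightarrow> gf16 \<Rightarrow> gf16" where
  "gf16_add (GF a0 a1 a2 a3) (GF b0 b1 b2 b3) =
    GF (a0 \<noteq> b0) (a1 \<noteq> b1) (a2 \<noteq> b2) (a3 \<noteq> b3)"

fun gf16_mult :: "gf16 \<Rightarrow> gf16 \<Rightarrow> gf16" where
  "gf16_mult (GF a0 a1 a2 a3) (GF b0 b1 b2 b3) =
    (let c4 = ((a1 \<and> b3) \<noteq> ((a2 \<and> b2) \<noteq> (a3 \<and> b1)))
     in GF ((a0 \<and> b0) \<noteq> (c4 \<noteq> ((a2 \<and> b3) \<noteq> (a3 \<and> b2))))
           ((a0 \<and> b1) \<noteq> ((a1 \<and> b0) \<noteq> (c4 \<noteq> (a3 \<and> b3))))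
           ((a0 \<and> b2) \<noteq> ((a1 \<and> b1) \<noteq> ((a2 \<and> b0) \<noteq> c4)))
           ((a0 \<and> b3) \<noteq> ((a1 \<and> b2) \<noteq> ((a2 \<and> b1) \<noteq> ((a3 \<and> b0) \<noteq> c4)))))"

definition gf16_zero :: gf16 where "gf16_zero = GF False False False False"
definition gf16_one :: gf16 where "gf16_one = GF True False False False"
definition gf16_gen :: gf16 where "gf16_gen = GF False True False False"

definition gf16_elems :: "gf16 list" where
  "gf16_elems = concat (map (\<lambda>f. [f False, f True])
     (concat (map (\<lambda>f. [f False, f True])
     (concat (map (\<lambda>f. [f False, f True]) [GF False, GF True])))))"

lemma set_gf16_elems: "set gf16_elems = UNIV"
proof -
  have "x \<in> set gf16_elems" for x
  proof (cases x)
    case (GF x0 x1 x2 x3)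
    then show ?thesis
      by (cases x0; cases x1; cases x2; cases x3) (simp_all add: gf16_elems_def)
  qed
  then show ?thesis
    by blast
qed

lemma distinct_gf16_elems: "distinct gf16_elems"
  by (simp add: gf16_elems_def)

definition gf16_delta :: "gf16 \<Rightarrow> gf16 \<Rightarrow> gf16" where
  "gf16_delta b c = gf16_add (gf16_mult b (gf16_mult b b)) (gf16_mult c c)"

text \<open>
The induced map for trace 1, where \<open>\<delta> = \<beta>^3 + \<gamma>^2\<close> is forced by the criterion of Hermite.
\<close>
definition gf16_nonic :: "gf16 \<Rightarrow> gf16 \<Rightarrow> gf16 \<Rightarrow> gf16" where
  "gf16_nonic b c y =
    (let w = gf16_mult y y
     in gf16_mult y (gf16_add (gf16_delta b c) (gf16_mult w (gf16_add c
          (gf16_mult w (gf16_add b (gf16_mult w (gf16_add gf16_one w))))))))"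

text \<open>
Nonzero codes have inverses; this is what makes the evaluation of codes injective.
\<close>
lemma gf16_inverse_check:
  "list_all (\<lambda>x. x = gf16_zero \<or> list_ex (\<lambda>y. gf16_mult x y = gf16_one) gf16_elems) gf16_elems"
  by code_simp

text \<open>
The exceptional pair \<open>\<gamma> = z\<close>, \<open>\<beta> = 1 + z\<close> does give a permutation of the field with 16 elements.
It is excluded below because its quartic is a product of two different irreducible quadratics,
which is not the characteristic polynomial of an element.
\<close>
lemma gf16_search:
  "list_all (\<lambda>c. list_all (\<lambda>b. distinct (map (gf16_nonic b c) gf16_elems) \<longrightarrow>
     c = gf16_gen \<and> b = gf16_add gf16_one gf16_gen) gf16_elems) [gf16_one, gf16_gen]"
  by code_simp


context binary_quartic_extension
begin

primrec gf16_eval :: "'a \<Rightarrow> gf16 \<Rightarrow> 'a" where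
  "gf16_eval z (GF x0 x1 x2 x3) = of_bool x0 + of_bool x1 * z + of_bool x2 * z\<^sup>2 + of_bool x3 * z ^ 3"

lemma of_bool_neq: "of_bool (P \<noteq> Q) = of_bool P + (of_bool Q :: 'a)"
  by (cases P; cases Q) simp_all

lemma gf16_eval_add: "gf16_eval z (gf16_add x y) = gf16_eval z x + gf16_eval z y"
  by (cases x; cases y) (simp add: of_bool_neq algebra_simps del: of_bool_eq_iff)

lemma gf16_eval_zero [simp]: "gf16_eval z gf16_zero = 0"
  and gf16_eval_one [simp]: "gf16_eval z gf16_one = 1"
  and gf16_eval_gen [simp]: "gf16_eval z gf16_gen = z"
  by (simp_all add: gf16_zero_def gf16_one_def gf16_gen_def)

lemma power_5_eq_1:
  assumes z: "z ^ 4 = z ^ 3 + z\<^sup>2 + z + (1 :: 'a)"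
  shows "z ^ 5 = 1"
proof -
  have "z ^ 5 = z * z ^ 4"
    by (simp flip: power_Suc)
  also have "\<dots> = z ^ 4 + (z ^ 3 + z\<^sup>2 + z)"
    by (subst z) (simp add: algebra_simps eval_nat_numeral)
  also have "\<dots> = 1"
    by (simp add: z ac_simps)
  finally show ?thesis .
qed

lemma gf16_eval_mult:
  assumes z: "z ^ 4 = z ^ 3 + z\<^sup>2 + z + 1"
  shows "gf16_eval z (gf16_mult x y) = gf16_eval z x * gf16_eval z y"
proof -
  obtain a0 a1 a2 a3 b0 b1 b2 b3 where xy: "x = GF a0 a1 a2 a3" "y = GF b0 b1 b2 b3"
    by (cases x; cases y)
  define t :: "bool \<Rightarrow> bool \<Rightarrow> 'a" where "t a b = of_bool a * of_bool b" for a b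
  have z5: "z ^ 5 = 1"
    by (rule power_5_eq_1[OF z])
  have z6: "z ^ 6 = z"
    using z5 by (simp add: eval_nat_numeral)
  have "gf16_eval z x * gf16_eval z y =
      t a0 b0 + (t a0 b1 + t a1 b0) * z + (t a0 b2 + t a1 b1 + t a2 b0) * z\<^sup>2
      + (t a0 b3 + t a1 b2 + t a2 b1 + t a3 b0) * z ^ 3
      + (t a1 b3 + t a2 b2 + t a3 b1) * z ^ 4 + (t a2 b3 + t a3 b2) * z ^ 5 + t a3 b3 * z ^ 6"
    by (simp add: xy t_def algebra_simps eval_nat_numeral)
  also have "\<dots> = gf16_eval z (gf16_mult x y)"
    unfolding z z5 z6 xy gf16_mult.simps Let_def gf16_eval.simps
    by (simp only: of_bool_neq of_bool_conj flip: t_def) (simp add: algebra_simps)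
  finally show ?thesis ..
qed

lemma bij_gf16_eval:
  assumes q: "q = 16" and z: "z \<in> K" "z ^ 4 = z ^ 3 + z\<^sup>2 + z + 1"
  shows "bij_betw (gf16_eval z) UNIV K"
proof -
  have nonzero: "x = gf16_zero" if "gf16_eval z x = 0" for x
  proof (rule ccontr)
    assume "x \<noteq> gf16_zero"
    then obtain y where "gf16_mult x y = gf16_one"
      using gf16_inverse_check by (auto simp: list_all_iff list_ex_iff set_gf16_elems)
    then have "gf16_eval z x * gf16_eval z y = 1"
      using gf16_eval_mult[OF z(2), of x y] by simp
    then show False
      using that by simp
  qed
  have inj: "inj (gf16_eval z)"
  proof (rule injI)
    fix x y
    assume "gf16_eval z x = gf16_eval z y"
    then have "gf16_add x y = gf16_zero"
      by (intro nonzero) (simp add: gf16_eval_add)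
    then show "x = y"
      by (cases x; cases y) (simp add: gf16_zero_def)
  qed
  have "card (UNIV :: gf16 set) = length gf16_elems"
    using distinct_card[OF distinct_gf16_elems] by (simp add: set_gf16_elems)
  then have "card (range (gf16_eval z)) = card K"
    by (simp add: card_image[OF inj] card_K q gf16_elems_def)
  moreover have "gf16_eval z x \<in> K" for x
    using z(1) by (cases x) (auto intro!: K_add K_mult K_power simp: of_bool_def)
  ultimately have "range (gf16_eval z) = K"
    by (intro card_seteq) auto
  then show ?thesis
    using inj by (simp add: bij_betw_def)
qed

section \<open>The case q = 16\<close>

text \<open>
The search leaves only \<open>\<gamma> = z\<close> and \<open>\<beta> = 1 + z\<close>. There the characteristic polynomial of \<open>a\<close> is
\<open>(X^2 + z X + z^3) (X^2 + (1 + z) X + 1 + z^2 + z^3)\<close>, so \<open>a\<close> satisfies a quadratic equation over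
\<open>K\<close> and its relative trace is 0 instead of 1.
\<close>
lemma not_bij_trace_1:
  assumes q: "q = 16" and z: "z \<in> K" "z ^ 4 = z ^ 3 + z\<^sup>2 + z + 1"
    and trace: "conj_e1 a = 1"
    and \<gamma>: "conj_e3 a = 1 \<or> conj_e3 a = z"
    and E: "rel_norm a = conj_e2 a ^ 3 + (conj_e3 a)\<^sup>2"
  shows "\<not> bij_betw (reduced a) K K"
proof
  assume bij: "bij_betw (reduced a) K K"
  have range: "range (gf16_eval z) = K" and inj_eval: "inj (gf16_eval z)"
    using bij_gf16_eval[OF q z] by (auto simp: bij_betw_def)
  define \<beta> \<gamma> where "\<beta> = conj_e2 a" and "\<gamma> = conj_e3 a"
  obtain b where b: "\<beta> = gf16_eval z b"
    using conj_e_in_K(2)[of a] range unfolding \<beta>_def by (metis rangeE)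
  obtain c where c: "\<gamma> = gf16_eval z c" "c \<in> {gf16_one, gf16_gen}"
    using \<gamma> gf16_eval_one gf16_eval_gen unfolding \<gamma>_def by (metis insertCI)
  note eval = gf16_eval_add gf16_eval_mult[OF z(2)]
  have eval_nonic: "gf16_eval z (gf16_nonic b c y) = reduced a (gf16_eval z y)" for y
  proof -
    have "gf16_eval z y \<in> K"
      using range by auto
    then show ?thesis
      by (simp add: reduced_eq_nonic nonic_def trace E gf16_nonic_def gf16_delta_def Let_def eval
          power3_eq_cube power2_eq_square algebra_simps flip: \<beta>_def \<gamma>_def b c(1))
  qed
  have "distinct (map (gf16_nonic b c) gf16_elems)"
    unfolding distinct_map
  proof (intro conjI distinct_gf16_elems inj_onI)
    fix x y
    assume "gf16_nonic b c x = gf16_nonic b c y"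
    then have "reduced a (gf16_eval z x) = reduced a (gf16_eval z y)"
      by (metis eval_nonic)
    moreover have "inj_on (reduced a) K"
      using bij by (rule bij_betw_imp_inj_on)
    ultimately have "gf16_eval z x = gf16_eval z y"
      using range by (metis inj_onD rangeI)
    then show "x = y"
      using inj_eval by (rule injD[rotated])
  qed
  then have "c = gf16_gen" "b = gf16_add gf16_one gf16_gen"
    using gf16_search c(2) by (auto simp: list_all_iff set_gf16_elems)
  then have "\<gamma> = z" "\<beta> = 1 + z"
    by (simp_all add: b c gf16_eval_add)
  define s t where "s = 1 + z" and "t = 1 + z\<^sup>2 + z ^ 3"
  have "(a\<^sup>2 + z * a + z ^ 3) * (a\<^sup>2 + s * a + t) =
      a ^ 4 + a ^ 3 + (1 + z) * a\<^sup>2 + z * a + (z ^ 3 + z ^ 5 + z * z ^ 5)"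
    by (simp add: s_def t_def algebra_simps eval_nat_numeral)
  also have "\<dots> = a ^ 4 + a ^ 3 + (1 + z) * a\<^sup>2 + z * a + ((1 + z) ^ 3 + z\<^sup>2)"
    unfolding power_5_eq_1[OF z(2)] by (simp add: algebra_simps eval_nat_numeral)
  also have "\<dots> = 0"
    using conj_quartic_root[of a] trace E \<open>\<gamma> = z\<close> \<open>\<beta> = 1 + z\<close> by (simp add: \<beta>_def \<gamma>_def)
  finally consider "a\<^sup>2 + z * a + z ^ 3 = 0" | "a\<^sup>2 + s * a + t = 0"
    by auto
  then have "conj_e1 a = 0"
    using z(1) by cases (auto intro!: conj_e1_eq_0 K_add K_power simp: s_def t_def)
  then show False
    using trace by simp
qed


lemma fifth_root_of_unity:
  assumes "x ^ 5 = 1" "x \<noteq> (1 :: 'a)"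
  shows "x ^ 4 = x ^ 3 + x\<^sup>2 + x + 1"
proof -
  have "(x + 1) * (x ^ 4 + (x ^ 3 + x\<^sup>2 + x + 1)) = x ^ 5 + 1"
    by (simp add: algebra_simps eval_nat_numeral)
  then have "(x + 1) * (x ^ 4 + (x ^ 3 + x\<^sup>2 + x + 1)) = 0"
    using assms(1) by simp
  then show ?thesis
    using assms(2) by (simp only: mult_eq_0_iff add_eq_0_iff_eq) blast
qed

lemma exists_primitive_fifth_root:
  assumes q: "q = 16"
  obtains z where "z \<in> K" "z ^ 4 = z ^ 3 + z\<^sup>2 + z + 1"
proof -
  obtain y where y: "y \<in> K" "y \<noteq> 0" "y ^ 3 \<noteq> 1"
    using exists_power_neq_1[of 3] q by auto
  have "(y ^ 3) ^ 5 = 1"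
    using K_power_q_minus_1[OF y(1,2)] by (simp add: q flip: power_mult)
  with that[of "y ^ 3"] y show ?thesis
    using fifth_root_of_unity[of "y ^ 3"] by auto
qed

text \<open>
The polynomial is \<open>L(z) + \<delta>\<close> with an additive map \<open>L\<close>, which is onto \<open>K\<close> if its kernel is trivial.
With \<open>z = \<gamma> v / \<beta>\<close>, a nonzero element of the kernel would give \<open>v^3 + v + 1 = 0\<close>, hence
\<open>v^8 = v\<close>; but \<open>v^16 = v\<close>, so that \<open>v^2 = v\<close>, and neither 0 nor 1 is a root of this cubic.
\<close>
lemma trace_0_quartic_root:
  assumes q: "q = 16" and K: "\<beta> \<in> K" "\<gamma> \<in> K" "\<delta> \<in> K"
    and "\<gamma> \<noteq> 0" and rel: "\<beta> ^ 3 = \<gamma>\<^sup>2"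
  shows "\<exists>z\<in>K. z ^ 4 + \<beta> * z\<^sup>2 + \<gamma> * z + \<delta> = 0"
proof -
  define L where "L z = z ^ 4 + \<beta> * z\<^sup>2 + \<gamma> * z" for z
  have "\<beta> \<noteq> 0"
    using rel \<open>\<gamma> \<noteq> 0\<close> by auto
  have L_add: "L (x + y) = L x + L y" for x y
    using power_2_power_add[of x y 2] by (simp add: L_def square_add algebra_simps)
  have kernel: "z = 0" if "z \<in> K" "L z = 0" for z
  proof (rule ccontr)
    assume "z \<noteq> 0"
    define v where "v = z * \<beta> / \<gamma>"
    have z: "z = \<gamma> * v / \<beta>"
      using \<open>\<beta> \<noteq> 0\<close> \<open>\<gamma> \<noteq> 0\<close> by (simp add: v_def)
    have "v \<noteq> 0"
      using \<open>\<beta> \<noteq> 0\<close> \<open>\<gamma> \<noteq> 0\<close> \<open>z \<noteq> 0\<close> by (simp add: v_def)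
    have "\<beta> ^ 3 * L z = \<gamma> ^ 4 * v ^ 4 / \<beta> + \<beta> ^ 3 * \<gamma>\<^sup>2 * v\<^sup>2 / \<beta> + \<beta> ^ 3 * \<gamma>\<^sup>2 * v / \<beta>"
      using \<open>\<beta> \<noteq> 0\<close> by (simp add: L_def z field_simps eval_nat_numeral)
    also have "\<dots> = \<gamma> ^ 4 / \<beta> * (v * (v ^ 3 + v + 1))"
      unfolding rel by (simp add: algebra_simps eval_nat_numeral add_divide_distrib)
    finally have "v ^ 3 + v + 1 = 0"
      using \<open>\<beta> \<noteq> 0\<close> \<open>\<gamma> \<noteq> 0\<close> \<open>v \<noteq> 0\<close> \<open>L z = 0\<close> by simp
    then have "v ^ 3 = v + 1"
      by (metis add.assoc add_eq_0_iff_eq)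
    have "v ^ 4 = v\<^sup>2 + v"
      using \<open>v ^ 3 = v + 1\<close> by (simp add: eval_nat_numeral algebra_simps)
    have "v ^ 8 = (v ^ 4)\<^sup>2"
      by (simp flip: power_mult)
    also have "\<dots> = v ^ 4 + v\<^sup>2"
      by (simp add: \<open>v ^ 4 = v\<^sup>2 + v\<close> square_add flip: power_mult)
    also have "\<dots> = v"
      by (simp add: \<open>v ^ 4 = v\<^sup>2 + v\<close> ac_simps)
    finally have "v ^ 16 = v\<^sup>2"
      using power_mult[of v 8 2] by simp
    moreover have "v ^ 16 = v"
      using that(1) K by (auto simp: v_def K_iff q power_divide power_mult_distrib)
    ultimately have "v = 1"
      using \<open>v \<noteq> 0\<close> by (simp add: power2_eq_square)
    then show False
      using \<open>v ^ 3 = v + 1\<close> by simp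
  qed
  have "inj_on L K"
  proof (rule inj_onI)
    fix x y
    assume "x \<in> K" "y \<in> K" "L x = L y"
    then have "x + y = 0"
      by (auto simp: L_add intro!: kernel[of "x + y"])
    then show "x = y"
      by (simp add: add_eq_0_iff_eq)
  qed
  moreover have "L ` K \<subseteq> K"
    using K by (auto simp: L_def intro!: K_add K_mult K_power)
  ultimately have "L ` K = K"
    by (intro endo_inj_surj) auto
  then obtain z where "z \<in> K" "L z = \<delta>"
    using K(3) by (metis imageE)
  then have "L z + \<delta> = 0"
    by simp
  then show ?thesis
    using \<open>z \<in> K\<close> unfolding L_def by blast
qed

text \<open>
For \<open>q = 16\<close> the criterion of Hermite for the exponents 5 and 3 gives \<open>\<gamma>^5 = 1\<close> and
\<open>\<gamma>^2 + \<beta>^3 + \<delta> \<alpha>^2 = 0\<close>. If \<open>\<alpha> = 0\<close>, the induced map has a second zero. Otherwise \<open>\<alpha>\<close> is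
normalized to 1, the second relation determines \<open>\<delta>\<close>, and only finitely many pairs \<open>\<beta>\<close>, \<open>\<gamma>\<close>
remain. Choosing \<open>z = \<gamma>\<close> unless \<open>\<gamma> = 1\<close> leaves two values of \<open>\<gamma>\<close> to search.
\<close>
lemma not_bij_16:
  assumes q: "q = 16" and "a \<noteq> 0"
  shows "\<not> bij_betw (reduced a) K K"
proof
  assume bij: "bij_betw (reduced a) K K"
  have "q = 4 ^ 2" "q - 1 = 15" "repunit4 2 = 5"
    by (simp_all add: q numeral_2_eq_2)
  have rels: "conj_e3 b ^ 5 = 1 \<and> (conj_e3 b)\<^sup>2 + conj_e2 b ^ 3 + rel_norm b * (conj_e1 b)\<^sup>2 = 0"
    if "bij_betw (reduced b) K K" for b
  proof -
    note bij' = that[unfolded bij_reduced_iff_nonic]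
    have "conj_e3 b ^ repunit4 2 = 1"
      by (rule nonic_hermite_third[OF bij' \<open>q = 4 ^ 2\<close>]) simp
    moreover have "coeff (nonic (conj_e1 b) (conj_e2 b) (conj_e3 b) (rel_norm b) ^ 3) (q - 1) = 0"
      by (rule nonic_hermite[OF bij']) (simp_all add: q)
    ultimately show ?thesis
      unfolding \<open>q - 1 = 15\<close> coeff_nonic_cube[OF CHAR_eq_2] by (simp add: \<open>repunit4 2 = 5\<close>)
  qed
  show False
  proof (cases "conj_e1 a = 0")
    case True
    have "conj_e3 a \<noteq> 0" "conj_e2 a ^ 3 = (conj_e3 a)\<^sup>2"
      using rels[OF bij] True by (auto simp: add_eq_0_iff_eq)
    then obtain w where w: "w \<in> K" "w ^ 4 + conj_e2 a * w\<^sup>2 + conj_e3 a * w + rel_norm a = 0"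
      using trace_0_quartic_root[OF q conj_e_in_K(2,3) rel_norm_in_K] by metis
    (* the square root of w, since w^16 = w *)
    define y where "y = w ^ 8"
    have "y\<^sup>2 = w"
      using w(1) by (simp add: y_def K_iff q flip: power_mult)
    have "y \<in> K"
      using w(1) by (auto simp: y_def)
    have "reduced a y = reduced a 0"
      using rel_norm_add[OF w(1), of a] w(2) by (simp add: reduced_def \<open>y\<^sup>2 = w\<close> True)
    then have "y = 0"
      using bij \<open>y \<in> K\<close> K_0 by (metis bij_betw_imp_inj_on inj_onD)
    then have "rel_norm a = 0"
      using w(2) \<open>y\<^sup>2 = w\<close> by simp
    then show False
      using \<open>a \<noteq> 0\<close> by simp
  next
    case False
    (* the square root of the trace *)
    define c where "c = conj_e1 a ^ 8"
    have c2: "c\<^sup>2 = conj_e1 a"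
      using conj_e_in_K(1)[of a] by (simp add: c_def K_iff q flip: power_mult)
    have c: "c \<in> K" "c \<noteq> 0"
      using conj_e_in_K(1)[of a] False by (auto simp: c_def)
    define b where "b = a / c\<^sup>2"
    have bij_b: "bij_betw (reduced b) K K"
      unfolding b_def by (rule bij_reduced_scale[OF bij c])
    have trace: "conj_e1 b = 1"
      using conj_e1_scale[OF conj_e_in_K(1), of a a] False by (simp add: b_def c2)
    have E: "rel_norm b = conj_e2 b ^ 3 + (conj_e3 b)\<^sup>2"
      using rels[OF bij_b] by (simp add: trace add_eq_0_iff_eq add.commute)
    obtain z where z: "z \<in> K" "z ^ 4 = z ^ 3 + z\<^sup>2 + z + 1" "conj_e3 b = 1 \<or> conj_e3 b = z"
    proof (cases "conj_e3 b = 1")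
      case True
      then show ?thesis
        using exists_primitive_fifth_root[OF q] that by metis
    next
      case False
      then show ?thesis
        using that[of "conj_e3 b"] fifth_root_of_unity[of "conj_e3 b"] rels[OF bij_b]
        by (auto intro: conj_e_in_K)
    qed
    show False
      using not_bij_trace_1[OF q z(1,2) trace z(3) E] bij_b by contradiction
  qed
qed

end

section \<open>The theorem\<close>

theorem theorem11:
  fixes n q :: nat and a :: "'a::{field, finite}"
  assumes "n \<ge> 4" and "even n" and "q = 2 ^ n"
    and "card (UNIV :: 'a set) = q ^ 4"
    and "a \<noteq> 0"
  shows "\<not> permutation_polynomial (f4 q a)"
proof
  assume perm: "permutation_polynomial (f4 q a)"
  interpret binary_quartic_extension q n "{x :: 'a. x ^ q = x}"
    using assms by unfold_locales auto
  let ?K = "{x :: 'a. x ^ q = x}"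
  obtain m where "n = 2 * m"
    using \<open>even n\<close> by (elim evenE)
  then have q: "q = 4 ^ m"
    by (simp add: \<open>q = 2 ^ n\<close> power_mult)
  have bij: "bij_betw (reduced a) ?K ?K"
    by (rule bij_reduced[OF perm])
  show False
  proof (cases "m = 2")
    case True
    then show ?thesis
      using not_bij_16[OF _ \<open>a \<noteq> 0\<close>] bij q by simp
  next
    case False
    then have "q = 4 ^ (m - 3 + 3)"
      using \<open>n \<ge> 4\<close> \<open>n = 2 * m\<close> q by simp
    then show ?thesis
      using not_bij_nonic_large bij unfolding bij_reduced_iff_nonic by blast
  qed
qed

end
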